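(* Let $G$ be a finitely generated group and $K$ a subgroup of $G$. Let $\psi:\Sigma\to G$ and $\psi':\Sigma'\to G$ be any two semigroup presentations of $G$. Then $L(G,K,\psi)$ is a context-free language if and only if $L(G,K,\psi')$ is a context-free language. That is, being context-free is a property of the pair $(G,K)$ that does not depend on the choice of the semigroup presentation.
   Context: A *semigroup presentation* of a finitely generated group $G$ is a (not necessarily injective) map $\psi:\Sigma\to G$ from a finite alphabet $\Sigma$ such that its extension to a monoid homomorphism $\psi:\Sigma^*\to G$ is surjective. For a subgroup $K\le G$ (not necessarily finitely generated), $L(G,K,\psi)=\{w\in\Sigma^*:\psi(w)\in K\}$. *)

theory Defs
  imports "HOL-Algebra.Generated_Groups"
begin

record ('v, 'a) cfg =
  variables :: "'v set"
  terminals :: "'a set"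
  productions :: "('v \<times> ('v + 'a) list) set"
  start :: 'v

text \<open>Variables are tagged \<open>Inl\<close> and terminals \<open>Inr\<close>, so the two alphabets are
  disjoint by construction.\<close>

definition wf_cfg :: "('v, 'a) cfg \<Rightarrow> bool" where
  "wf_cfg C \<longleftrightarrow> finite (variables C) \<and> finite (terminals C) \<and> start C \<in> variables C \<and>
     finite (productions C) \<and>
     productions C \<subseteq> variables C \<times> lists (variables C <+> terminals C)"

inductive derives_step :: "('v, 'a) cfg \<Rightarrow> ('v + 'a) list \<Rightarrow> ('v + 'a) list \<Rightarrow> bool"
  for C where
  "(T, u) \<in> productions C \<Longrightarrow> derives_step C (v1 @ [Inl T] @ v2) (v1 @ u @ v2)"

definition cfg_language :: "('v, 'a) cfg \<Rightarrow> 'a list set" where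
  "cfg_language C = {w. (derives_step C)\<^sup>*\<^sup>* [Inl (start C)] (map Inr w)}"

text \<open>A grammar has only finitely many variables, so naming them by natural numbers is no
  restriction.\<close>

definition context_free :: "'a set \<Rightarrow> 'a list set \<Rightarrow> bool" where
  "context_free \<Sigma> L \<longleftrightarrow>
     (\<exists>C :: (nat, 'a) cfg. wf_cfg C \<and> terminals C = \<Sigma> \<and> cfg_language C = L)"

definition finitely_generated :: "('g, 'm) monoid_scheme \<Rightarrow> bool" where
  "finitely_generated G \<longleftrightarrow> (\<exists>S. finite S \<and> S \<subseteq> carrier G \<and> generate G S = carrier G)"

text \<open>The extension of \<open>\<psi>\<close> to a monoid homomorphism on words.\<close>

definition word_hom :: "('g, 'm) monoid_scheme \<Rightarrow> ('a \<Rightarrow> 'g) \<Rightarrow> 'a list \<Rightarrow> 'g" where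
  "word_hom G \<psi> w = foldr (\<lambda>a g. \<psi> a \<otimes>\<^bsub>G\<^esub> g) w \<one>\<^bsub>G\<^esub>"

definition semigroup_presentation ::
    "('g, 'm) monoid_scheme \<Rightarrow> 'a set \<Rightarrow> ('a \<Rightarrow> 'g) \<Rightarrow> bool" where
  "semigroup_presentation G \<Sigma> \<psi> \<longleftrightarrow>
     finite \<Sigma> \<and> \<psi> \<in> \<Sigma> \<rightarrow> carrier G \<and> word_hom G \<psi> ` lists \<Sigma> = carrier G"

definition pair_language ::
    "('g, 'm) monoid_scheme \<Rightarrow> 'g set \<Rightarrow> 'a set \<Rightarrow> ('a \<Rightarrow> 'g) \<Rightarrow> 'a list set" where
  "pair_language G K \<Sigma> \<psi> = {w \<in> lists \<Sigma>. word_hom G \<psi> w \<in> K}"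

end

theory Submission
  imports Defs
begin

text \<open>Choosing for each letter \<open>b\<close> of \<open>\<Sigma>'\<close> a word \<open>h b\<close> over \<open>\<Sigma>\<close> representing the same group
  element makes the language of \<open>\<psi>'\<close> the preimage of the language of \<open>\<psi>\<close> under the homomorphism
  \<open>h\<close>, so it suffices that context-free languages are closed under inverse homomorphisms. Given a
  grammar, take new variables \<open>(p, \<alpha>, q)\<close>, where \<open>\<alpha>\<close> is a short sentential form and \<open>p\<close>, \<open>q\<close> are
  words of bounded length (the unread part of an image \<open>h b\<close> before and after \<open>\<alpha>\<close> is consumed);
  the new variable generates the words \<open>v\<close> such that \<open>p h(v) = w q\<close> for some \<open>w\<close> derivable
  from \<open>\<alpha>\<close>.\<close>

section \<open>Derivation trees of context-free grammars\<close>

text \<open>Derivations as trees instead of rewriting sequences: every symbol of the form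
  contributes its own factor of the word, so proofs go by induction without tracking the context of
  a rewritten variable.\<close>

inductive yields :: "('v \<times> ('v + 'a) list) set \<Rightarrow> ('v + 'a) list \<Rightarrow> 'a list \<Rightarrow> bool"
  for P where
  Nil: "yields P [] []"
| Terminal: "yields P \<alpha> w \<Longrightarrow> yields P (Inr a # \<alpha>) (a # w)"
| Variable: "(X, u) \<in> P \<Longrightarrow> yields P u w1 \<Longrightarrow> yields P \<alpha> w2 \<Longrightarrow> yields P (Inl X # \<alpha>) (w1 @ w2)"

inductive_cases yields_NilE: "yields P [] w"
inductive_cases yields_TerminalE: "yields P (Inr a # \<alpha>) w"
inductive_cases yields_VariableE: "yields P (Inl X # \<alpha>) w"

lemma yields_append:
  "yields P \<alpha> w1 \<Longrightarrow> yields P \<beta> w2 \<Longrightarrow> yields P (\<alpha> @ \<beta>) (w1 @ w2)"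
  by (induction rule: yields.induct) (auto intro: yields.intros)

text \<open>Symbols are expanded independently of their neighbours, so induction on
  \<open>\<alpha>\<close> peels off one factor of \<open>w\<close> per symbol.\<close>

lemma yields_appendE:
  assumes "yields P (\<alpha> @ \<beta>) w"
  obtains w1 w2 where "w = w1 @ w2" "yields P \<alpha> w1" "yields P \<beta> w2"
proof -
  have "\<exists>w1 w2. w = w1 @ w2 \<and> yields P \<alpha> w1 \<and> yields P \<beta> w2"
    using assms
  proof (induction \<alpha> arbitrary: w)
    case Nil
    then show ?case using yields.Nil by fastforce
  next
    case (Cons x \<alpha>)
    show ?case
    proof (cases x)
      case (Inl X)
      with Cons.prems obtain u w1 w2 where
        u: "(X, u) \<in> P" "yields P u w1" "yields P (\<alpha> @ \<beta>) w2" "w = w1 @ w2"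
        by (auto elim: yields_VariableE)
      with Cons.IH obtain w3 w4 where "w2 = w3 @ w4" "yields P \<alpha> w3" "yields P \<beta> w4"
        by blast
      with u Inl show ?thesis
        by (intro exI[of _ "w1 @ w3"] exI[of _ w4]) (auto intro: yields.Variable)
    next
      case (Inr a)
      with Cons.prems obtain w' where w': "yields P (\<alpha> @ \<beta>) w'" "w = a # w'"
        by (auto elim: yields_TerminalE)
      with Cons.IH obtain w3 w4 where "w' = w3 @ w4" "yields P \<alpha> w3" "yields P \<beta> w4"
        by blast
      with w' Inr show ?thesis
        by (intro exI[of _ "a # w3"] exI[of _ w4]) (auto intro: yields.Terminal)
    qed
  qed
  then show thesis using that by blast
qed

lemma yields_map_Inr: "yields P (map Inr w) w"
  by (induction w) (auto intro: yields.intros)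

lemma yields_singleton_iff: "yields P [Inl X] w \<longleftrightarrow> (\<exists>u. (X, u) \<in> P \<and> yields P u w)"
proof
  assume "yields P [Inl X] w"
  then show "\<exists>u. (X, u) \<in> P \<and> yields P u w"
    by (auto elim!: yields_VariableE yields_NilE)
next
  assume "\<exists>u. (X, u) \<in> P \<and> yields P u w"
  then show "yields P [Inl X] w"
    using yields.Variable[of X _ P w "[]" "[]"] yields.Nil by fastforce
qed

lemma derives_step_context:
  "derives_step C \<alpha> \<beta> \<Longrightarrow> derives_step C (\<gamma> @ \<alpha> @ \<delta>) (\<gamma> @ \<beta> @ \<delta>)"
proof (induction rule: derives_step.induct)
  case (1 T u v1 v2)
  then show ?case using derives_step.intros[of T u C "\<gamma> @ v1" "v2 @ \<delta>"] by simp
qed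

lemma derives_context:
  "(derives_step C)\<^sup>*\<^sup>* \<alpha> \<beta> \<Longrightarrow> (derives_step C)\<^sup>*\<^sup>* (\<gamma> @ \<alpha> @ \<delta>) (\<gamma> @ \<beta> @ \<delta>)"
  by (induction rule: rtranclp_induct)
    (auto intro: rtranclp.rtrancl_into_rtrancl derives_step_context simp del: append_assoc)

lemma yields_imp_derives:
  "yields (productions C) \<alpha> w \<Longrightarrow> (derives_step C)\<^sup>*\<^sup>* \<alpha> (map Inr w)"
proof (induction rule: yields.induct)
  case Nil
  then show ?case by simp
next
  case (Terminal \<alpha> w a)
  then show ?case using derives_context[of C \<alpha> "map Inr w" "[Inr a]" "[]"] by simp
next
  case (Variable X u w1 \<alpha> w2)
  have "derives_step C (Inl X # \<alpha>) (u @ \<alpha>)"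
    using derives_step.intros[OF Variable.hyps(1), of "[]" \<alpha>] by simp
  also have "(derives_step C)\<^sup>*\<^sup>* (u @ \<alpha>) (map Inr w1 @ \<alpha>)"
    using derives_context[OF Variable.IH(1), of "[]" \<alpha>] by simp
  also have "(derives_step C)\<^sup>*\<^sup>* (map Inr w1 @ \<alpha>) (map Inr w1 @ map Inr w2)"
    using derives_context[OF Variable.IH(2), of "map Inr w1" "[]"] by simp
  finally show ?case by simp
qed

text \<open>The trees grown from the symbols of \<open>u\<close> are gathered under the variable
  \<open>T\<close>. Converse induction along a rewriting sequence needs this.\<close>

lemma derives_step_yields:
  assumes "derives_step C \<alpha> \<beta>" and "yields (productions C) \<beta> w"
  shows "yields (productions C) \<alpha> w"
  using assms
proof cases
  case (1 T u v1 v2)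
  with assms(2) obtain w1 w2 w3 where "w = w1 @ w2 @ w3" "yields (productions C) v1 w1"
    "yields (productions C) u w2" "yields (productions C) v2 w3"
    by (metis yields_appendE)
  moreover from this 1(3) have "yields (productions C) (Inl T # v2) (w2 @ w3)"
    by (intro yields.Variable)
  ultimately show ?thesis using 1(1) by (simp add: yields_append)
qed

lemma derives_imp_yields:
  "(derives_step C)\<^sup>*\<^sup>* \<alpha> (map Inr w) \<Longrightarrow> yields (productions C) \<alpha> w"
  by (induction rule: converse_rtranclp_induct)
    (auto intro: yields_map_Inr derives_step_yields)

lemma cfg_language_yields: "cfg_language C = {w. yields (productions C) [Inl (start C)] w}"
  unfolding cfg_language_def using yields_imp_derives derives_imp_yields by blast

text \<open>\<open>cfg_language\<close> does not confine words to the alphabet; the shape of the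
  productions does.\<close>

lemma yields_in_lists:
  assumes "P \<subseteq> V \<times> lists (V <+> \<Sigma>)"
  shows "yields P \<alpha> w \<Longrightarrow> \<alpha> \<in> lists (V <+> \<Sigma>) \<Longrightarrow> w \<in> lists \<Sigma>"
proof (induction rule: yields.induct)
  case (Variable X u w1 \<alpha> w2)
  from Variable.hyps(1) assms have "u \<in> lists (V <+> \<Sigma>)" by blast
  with Variable show ?case by auto
qed auto

section \<open>Renaming the variables of a grammar\<close>

definition rename_productions ::
    "('v \<Rightarrow> 'w) \<Rightarrow> ('v \<times> ('v + 'a) list) set \<Rightarrow> ('w \<times> ('w + 'a) list) set" where
  "rename_productions f P = map_prod f (map (map_sum f id)) ` P"

lemma yields_rename:
  "yields P \<alpha> w \<Longrightarrow> yields (rename_productions f P) (map (map_sum f id) \<alpha>) w"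
proof (induction rule: yields.induct)
  case (Variable X u w1 \<alpha> w2)
  then have "(f X, map (map_sum f id) u) \<in> rename_productions f P"
    by (force simp: rename_productions_def)
  from yields.Variable[OF this Variable.IH] show ?case by simp
qed (auto intro: yields.intros)

text \<open>Renaming by \<open>g\<close> undoes renaming by \<open>f\<close>, so
  \<open>yields_rename\<close> serves for both directions of the equivalence of the two
  grammars.\<close>

lemma rename_productions_inverse:
  assumes P: "P \<subseteq> V \<times> lists (V <+> \<Sigma>)" and g: "\<And>X. X \<in> V \<Longrightarrow> g (f X) = X"
  shows "rename_productions g (rename_productions f P) = P"
proof -
  have "map_prod g (map (map_sum g id)) (map_prod f (map (map_sum f id)) x) = x"
    if "x \<in> P" for x
  proof -
    from subsetD[OF P that] obtain X u where x: "x = (X, u)" "X \<in> V" "set u \<subseteq> V <+> \<Sigma>"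
      by (auto simp: lists_eq_set)
    then have "map (map_sum g id \<circ> map_sum f id) u = u"
      by (intro map_idI) (auto simp: g)
    with x show ?thesis by (simp add: g)
  qed
  then show ?thesis
    by (simp add: rename_productions_def image_image)
qed

text \<open>\<open>context_free\<close> asks for numbers as variables; numbering the finite set
  \<open>V\<close> admits variables of any type, such as the triples built below.\<close>

lemma context_freeI:
  fixes V :: "'v set"
  assumes fin: "finite V" "finite \<Sigma>" "finite P" and S: "S \<in> V"
    and P: "P \<subseteq> V \<times> lists (V <+> \<Sigma>)"
    and L: "L = {w. yields P [Inl S] w}"
  shows "context_free \<Sigma> L"
proof -
  obtain f :: "'v \<Rightarrow> nat" where f: "inj_on f V"
    using finite_imp_inj_to_nat_seg[OF fin(1)] by blast
  define g where "g = the_inv_into V f"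
  have g: "g (f X) = X" if "X \<in> V" for X
    using that f by (simp add: g_def the_inv_into_f_f)
  define C where "C = \<lparr>variables = f ` V, terminals = \<Sigma>,
    productions = rename_productions f P, start = f S\<rparr>"
  have "wf_cfg C"
    using fin S P unfolding wf_cfg_def C_def rename_productions_def
    by (fastforce simp: in_lists_conv_set)
  moreover have "yields (rename_productions f P) [Inl (f S)] w \<longleftrightarrow> yields P [Inl S] w" for w
  proof
    assume "yields (rename_productions f P) [Inl (f S)] w"
    from yields_rename[OF this, of g] show "yields P [Inl S] w"
      using rename_productions_inverse[OF P, of g f] g S by simp
  next
    assume "yields P [Inl S] w"
    from yields_rename[OF this, of f]
    show "yields (rename_productions f P) [Inl (f S)] w" by simp
  qed
  then have "cfg_language C = L"
    by (simp add: cfg_language_yields C_def L)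
  ultimately show ?thesis
    unfolding context_free_def by (metis C_def cfg.select_convs(2))
qed

section \<open>The triple construction for inverse homomorphisms\<close>

text \<open>The decomposition behind the production for \<open>Inl X # \<alpha>\<close> below: the part \<open>r\<close> of the image
  that remains after reading \<open>w\<close> is again short.\<close>

lemma split_hom_image:
  assumes "p @ concat (map h v) = w @ x" and "length p \<le> N"
    and "\<And>b. b \<in> set v \<Longrightarrow> length (h b) \<le> N"
  shows "\<exists>v1 v2 r. v = v1 @ v2 \<and> p @ concat (map h v1) = w @ r \<and>
    r @ concat (map h v2) = x \<and> length r \<le> N"
  using assms
proof (induction v arbitrary: p w)
  case Nil
  then show ?case by force
next
  case (Cons b v)
  show ?case
  proof (cases "length w \<le> length p")
    \<comment> \<open>\<open>w\<close> ends inside \<open>p\<close>: no letter of \<open>v\<close>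
      is read, and \<open>r\<close> is the rest of \<open>p\<close>.\<close>
    case True
    with Cons.prems(1) obtain r where "p = w @ r" "r @ concat (map h (b # v)) = x"
      by (auto simp: append_eq_append_conv2)
    with Cons.prems(2) show ?thesis
      by (intro exI[of _ "[]"] exI[of _ "b # v"] exI[of _ r]) auto
  next
    \<comment> \<open>\<open>w\<close> extends beyond \<open>p\<close>: the image \<open>h b\<close>
      takes over the role of \<open>p\<close>, and its length is again at most
      \<open>N\<close>.\<close>
    case False
    with Cons.prems(1) obtain w' where w': "w = p @ w'" "h b @ concat (map h v) = w' @ x"
      by (auto simp: append_eq_append_conv2)
    from Cons.IH[OF w'(2)] Cons.prems(3) obtain v1 v2 r where
      "v = v1 @ v2" "h b @ concat (map h v1) = w' @ r" "r @ concat (map h v2) = x" "length r \<le> N"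
      by auto
    with w' show ?thesis
      by (intro exI[of _ "b # v1"] exI[of _ v2] exI[of _ r]) auto
  qed
qed

type_synonym ('v, 'a) inv_var = "'a list \<times> ('v + 'a) list \<times> 'a list"

text \<open>\<open>F\<close> is the set of admissible sentential forms and \<open>Q\<close> the set of admissible unread words.\<close>

inductive_set inv_productions ::
    "('v \<times> ('v + 'a) list) set \<Rightarrow> ('v + 'a) list set \<Rightarrow> 'a list set \<Rightarrow> 'b set \<Rightarrow> ('b \<Rightarrow> 'a list) \<Rightarrow>
      (('v, 'a) inv_var \<times> (('v, 'a) inv_var + 'b) list) set"
  for P F Q \<Sigma>' h where
  stop: "q \<in> Q \<Longrightarrow> [] \<in> F \<Longrightarrow> ((q, [], q), []) \<in> inv_productions P F Q \<Sigma>' h"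
| emit: "b \<in> \<Sigma>' \<Longrightarrow> p \<in> Q \<Longrightarrow> p @ h b \<in> Q \<Longrightarrow> \<alpha> \<in> F \<Longrightarrow> q \<in> Q \<Longrightarrow>
    ((p, \<alpha>, q), [Inr b, Inl (p @ h b, \<alpha>, q)]) \<in> inv_productions P F Q \<Sigma>' h"
| read: "a # p \<in> Q \<Longrightarrow> p \<in> Q \<Longrightarrow> Inr a # \<alpha> \<in> F \<Longrightarrow> \<alpha> \<in> F \<Longrightarrow> q \<in> Q \<Longrightarrow>
    ((a # p, Inr a # \<alpha>, q), [Inl (p, \<alpha>, q)]) \<in> inv_productions P F Q \<Sigma>' h"
| expand: "(X, u) \<in> P \<Longrightarrow> p \<in> Q \<Longrightarrow> r \<in> Q \<Longrightarrow> q \<in> Q \<Longrightarrow> u \<in> F \<Longrightarrow> \<alpha> \<in> F \<Longrightarrow> Inl X # \<alpha> \<in> F \<Longrightarrow>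
    ((p, Inl X # \<alpha>, q), [Inl (p, u, r), Inl (r, \<alpha>, q)]) \<in> inv_productions P F Q \<Sigma>' h"

text \<open>Yields both well-formedness and finiteness of the new grammar: over a finite alphabet
  there are finitely many right-hand sides of length at most 2.\<close>

lemma inv_productions_subset:
  "inv_productions P F Q \<Sigma>' h
    \<subseteq> (Q \<times> F \<times> Q) \<times> {\<beta> \<in> lists (Q \<times> F \<times> Q <+> \<Sigma>'). length \<beta> \<le> 2}"
proof
  fix x assume x: "x \<in> inv_productions P F Q \<Sigma>' h"
  obtain p \<alpha> q \<beta> where "x = ((p, \<alpha>, q), \<beta>)" by (metis surj_pair)
  from x show "x \<in> (Q \<times> F \<times> Q) \<times> {\<beta> \<in> lists (Q \<times> F \<times> Q <+> \<Sigma>'). length \<beta> \<le> 2}"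
    unfolding \<open>x = ((p, \<alpha>, q), \<beta>)\<close> by cases auto
qed

text \<open>Sentential forms of the new grammar also contain terminals and several variables;
  \<open>inv_meaning\<close> extends the intended meaning of a variable to them.\<close>

fun inv_meaning ::
    "('v \<times> ('v + 'a) list) set \<Rightarrow> ('b \<Rightarrow> 'a list) \<Rightarrow> (('v, 'a) inv_var + 'b) list \<Rightarrow> 'b list \<Rightarrow> bool"
where
  "inv_meaning P h [] v \<longleftrightarrow> v = []"
| "inv_meaning P h (Inr b # \<beta>) v \<longleftrightarrow> (\<exists>v'. v = b # v' \<and> inv_meaning P h \<beta> v')"
| "inv_meaning P h (Inl (p, \<alpha>, q) # \<beta>) v \<longleftrightarrow>
    (\<exists>v1 v2 w. v = v1 @ v2 \<and> yields P \<alpha> w \<and> p @ concat (map h v1) = w @ q \<and>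
      inv_meaning P h \<beta> v2)"

text \<open>Each rule respects the equation \<open>p @ concat (map h v) = w @ q\<close>:
  \<open>emit\<close> moves \<open>h b\<close> into the unread word, \<open>read\<close> adds a
  letter in front of both sides, and \<open>expand\<close> chains two equations that meet at
  \<open>r\<close>.\<close>

lemma inv_productions_sound:
  "yields (inv_productions P F Q \<Sigma>' h) \<beta> v \<Longrightarrow> inv_meaning P h \<beta> v"
proof (induction rule: yields.induct)
  case (Variable X u v1 \<beta> v2)
  obtain p \<alpha> q where X: "X = (p, \<alpha>, q)" by (cases X)
  from Variable.hyps(1) Variable.IH(1)
  have "\<exists>w. yields P \<alpha> w \<and> p @ concat (map h v1) = w @ q"
    unfolding X
  proof cases
    case stop
    with Variable.IH(1) show ?thesis by (auto intro: yields.Nil)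
  next
    case (emit b)
    with Variable.IH(1) show ?thesis by auto
  next
    case (read a p' \<alpha>')
    with Variable.IH(1) obtain w where "yields P \<alpha>' w" "p' @ concat (map h v1) = w @ q" by auto
    with read show ?thesis by (intro exI[of _ "a # w"]) (auto intro: yields.Terminal)
  next
    case (expand Y u' r \<alpha>')
    with Variable.IH(1) obtain v3 v4 w w' where
      v: "v1 = v3 @ v4" and w: "yields P u' w" "p @ concat (map h v3) = w @ r"
      "yields P \<alpha>' w'" "r @ concat (map h v4) = w' @ q" by auto
    have "p @ concat (map h v1) = (w @ w') @ q"
      using v w(2,4) by (metis append.assoc concat_append map_append)
    with expand w show ?thesis by (blast intro: yields.Variable)
  qed
  with Variable.IH(2) X show ?case by auto
qed auto

text \<open>Induction on the tree that yields \<open>w\<close>, for all \<open>p\<close>,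
  \<open>q\<close> and \<open>v\<close>. The difficulty is to keep every unread word in
  \<open>Q\<close>; each case secures this in its own way.\<close>

lemma inv_productions_complete:
  fixes P :: "('v \<times> ('v + 'a) list) set" and h :: "'b \<Rightarrow> 'a list"
    and \<Sigma> :: "'a set" and N :: nat
  defines "Q \<equiv> {p \<in> lists \<Sigma>. length p \<le> N}"
  assumes h: "\<And>b. b \<in> \<Sigma>' \<Longrightarrow> h b \<in> Q"
    and F: "[] \<in> F" "\<And>x \<alpha>. x # \<alpha> \<in> F \<Longrightarrow> \<alpha> \<in> F" "\<And>X u. (X, u) \<in> P \<Longrightarrow> u \<in> F"
  shows "yields P \<alpha> w \<Longrightarrow> \<alpha> \<in> F \<Longrightarrow> p \<in> Q \<Longrightarrow> q \<in> Q \<Longrightarrow> v \<in> lists \<Sigma>' \<Longrightarrow>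
    p @ concat (map h v) = w @ q \<Longrightarrow> yields (inv_productions P F Q \<Sigma>' h) [Inl (p, \<alpha>, q)] v"
    (is "_ \<Longrightarrow> _ \<Longrightarrow> _ \<Longrightarrow> _ \<Longrightarrow> _ \<Longrightarrow> _ \<Longrightarrow> yields ?P' _ _")
proof (induction arbitrary: p q v rule: yields.induct)
  have emit: "yields ?P' [Inl (p, \<alpha>, q)] (b # v)"
    if "b \<in> \<Sigma>'" "p \<in> Q" "p @ h b \<in> Q" "\<alpha> \<in> F" "q \<in> Q" "yields ?P' [Inl (p @ h b, \<alpha>, q)] v"
    for b p \<alpha> q v
    using that yields_singleton_iff[of ?P'] inv_productions.emit yields.Terminal by metis
  {
    case Nil
    from Nil.prems(2-5) show ?case
    proof (induction v arbitrary: p)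
      case Nil
      then have "((p, [], q), []) \<in> ?P'" using F by (auto intro: inv_productions.stop)
      then show ?case by (auto simp: yields_singleton_iff intro: yields.Nil)
    next
      case (Cons b v)
      then have q: "(p @ h b) @ concat (map h v) = q" by simp
      \<comment> \<open>The new unread word is a prefix of \<open>q\<close>, so it inherits the
        bounds of \<open>q\<close>.\<close>
      with Cons.prems(2) have "p @ h b \<in> Q" unfolding Q_def by auto
      with Cons q show ?case using F(1) by (intro emit) auto
    qed
  next
    case (Terminal \<alpha> w a)
    have read: "yields ?P' [Inl (a # p, Inr a # \<alpha>, q)] v"
      if "a # p \<in> Q" "v \<in> lists \<Sigma>'" "p @ concat (map h v) = w @ q" for p v
    proof -
      have \<alpha>: "\<alpha> \<in> F" using F(2) Terminal.prems(1) by blast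
      have p: "p \<in> Q" using that(1) by (auto simp: Q_def)
      then have "((a # p, Inr a # \<alpha>, q), [Inl (p, \<alpha>, q)]) \<in> ?P'"
        using \<alpha> that(1) Terminal.prems by (auto intro: inv_productions.read)
      then show ?thesis
        using Terminal.IH[OF \<alpha> p Terminal.prems(3) that(2,3)] yields_singleton_iff by metis
    qed
    from Terminal.prems(2,4,5) show ?case
    proof (induction v arbitrary: p)
      case Nil
      then show ?case using read[of "w @ q" "[]"] by simp
    next
      case (Cons b v)
      show ?case
      proof (cases p)
        \<comment> \<open>A letter is emitted here only when nothing is unread, so the new unread
          word is just \<open>h b\<close>.\<close>
        case Nil
        with Cons h[of b] Terminal.prems show ?thesis by (intro emit) auto
      next
        case (Cons c p')
        with Cons.prems show ?thesis using read[of p' "b # v"] by simp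
      qed
    qed
  next
    case (Variable X u w1 \<alpha> w2)
    \<comment> \<open>\<open>r\<close> is what remains unread once the expansion of \<open>X\<close>
      is complete; it links the two variables of the \<open>expand\<close> production.\<close>
    have "\<exists>v1 v2 r. v = v1 @ v2 \<and> p @ concat (map h v1) = w1 @ r \<and>
        r @ concat (map h v2) = w2 @ q \<and> length r \<le> N"
      using Variable.prems h by (intro split_hom_image) (auto simp: Q_def)
    then obtain v1 v2 r where v: "v = v1 @ v2" "p @ concat (map h v1) = w1 @ r"
      "r @ concat (map h v2) = w2 @ q" "length r \<le> N" by blast
    have "concat (map h v1) \<in> lists \<Sigma>"
      using v(1) Variable.prems(4) h by (fastforce simp: Q_def in_lists_conv_set)
    then have "w1 @ r \<in> lists \<Sigma>"
      using v(2) Variable.prems(2) by (metis (lifting) Q_def append_in_lists_conv mem_Collect_eq)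
    with v(4) have r: "r \<in> Q" by (simp add: Q_def)
    have u: "u \<in> F" and \<alpha>: "\<alpha> \<in> F"
      using F Variable.hyps(1) Variable.prems(1) by blast+
    have "yields ?P' ([Inl (p, u, r)] @ [Inl (r, \<alpha>, q)]) (v1 @ v2)"
      using Variable.prems v by (intro yields_append Variable.IH) (auto simp: r u \<alpha>)
    moreover have "((p, Inl X # \<alpha>, q), [Inl (p, u, r), Inl (r, \<alpha>, q)]) \<in> ?P'"
      using Variable r u \<alpha> by (intro inv_productions.expand)
    ultimately show ?case unfolding yields_singleton_iff v(1) by auto
  }
qed

text \<open>Length bounds leave finitely many triples, and the start triple has nothing unread on
  either side, so it describes the \<open>v\<close> whose image is derivable from
  \<open>S\<close>.\<close>

theorem context_free_inverse_hom:
  fixes h :: "'b \<Rightarrow> 'a list"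
  assumes cf: "context_free \<Sigma> L" and fin: "finite \<Sigma>'" and h: "h \<in> \<Sigma>' \<rightarrow> lists \<Sigma>"
  shows "context_free \<Sigma>' {v \<in> lists \<Sigma>'. concat (map h v) \<in> L}"
proof -
  from cf obtain C :: "(nat, 'a) cfg" where C: "wf_cfg C" "terminals C = \<Sigma>" "cfg_language C = L"
    unfolding context_free_def by blast
  define V where "V = variables C"
  define P where "P = productions C"
  define S where "S = start C"
  have wf: "finite V" "finite \<Sigma>" "S \<in> V" "finite P" "P \<subseteq> V \<times> lists (V <+> \<Sigma>)"
    and L: "L = {w. yields P [Inl S] w}"
    using C by (auto simp: wf_cfg_def V_def P_def S_def cfg_language_yields)
  \<comment> \<open>The 0 keeps \<open>Max\<close> defined when \<open>\<Sigma>'\<close> is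
    empty.\<close>
  define N where "N = Max (insert 0 ((length \<circ> h) ` \<Sigma>'))"
  \<comment> \<open>The 1 covers an empty \<open>P\<close> and makes the form \<open>[Inl S]\<close>
    admissible.\<close>
  define M where "M = Max (insert 1 ((length \<circ> snd) ` P))"
  define Q where "Q = {p \<in> lists \<Sigma>. length p \<le> N}"
  define F where "F = {\<alpha> \<in> lists (V <+> \<Sigma>). length \<alpha> \<le> M}"
  have finQ: "finite Q" and finF: "finite F"
    using wf finite_lists_length_le[of \<Sigma> N] finite_lists_length_le[of "V <+> \<Sigma>" M]
    by (simp_all add: Q_def F_def lists_eq_set conj_commute)
  have hQ: "h b \<in> Q" if "b \<in> \<Sigma>'" for b
    using that h fin by (auto simp: Q_def N_def)
  have F: "[] \<in> F" "\<And>x \<alpha>. x # \<alpha> \<in> F \<Longrightarrow> \<alpha> \<in> F" by (auto simp: F_def)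
  have FP: "u \<in> F" if "(X, u) \<in> P" for X u
  proof -
    have "length u \<le> M" unfolding M_def
      using wf(4) that by (intro Max_ge) (auto simp: rev_image_eqI)
    then show ?thesis using that wf(5) by (auto simp: F_def)
  qed
  have "1 \<le> M" unfolding M_def using wf(4) by (intro Max_ge) auto
  then have FS: "[Inl S] \<in> F" using wf(3) by (auto simp: F_def)
  have Q0: "[] \<in> Q" by (simp add: Q_def)
  define P' where "P' = inv_productions P F Q \<Sigma>' h"
  have P': "P' \<subseteq> (Q \<times> F \<times> Q) \<times> {\<beta> \<in> lists (Q \<times> F \<times> Q <+> \<Sigma>'). length \<beta> \<le> 2}"
    unfolding P'_def by (rule inv_productions_subset)
  have "finite {\<beta> \<in> lists (Q \<times> F \<times> Q <+> \<Sigma>'). length \<beta> \<le> 2}"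
    using finQ finF fin finite_lists_length_le[of "Q \<times> F \<times> Q <+> \<Sigma>'" 2]
    by (simp add: lists_eq_set conj_commute)
  then have finP': "finite P'"
    using finQ finF by (intro finite_subset[OF P'] finite_cartesian_product)
  have P'_sub: "P' \<subseteq> (Q \<times> F \<times> Q) \<times> lists (Q \<times> F \<times> Q <+> \<Sigma>')"
    using P' by blast
  have start: "([], [Inl S], []) \<in> Q \<times> F \<times> Q" using Q0 FS by simp
  show ?thesis
  proof (rule context_freeI[OF _ fin finP' start P'_sub])
    show "finite (Q \<times> F \<times> Q)" using finQ finF by simp
    show "{v \<in> lists \<Sigma>'. concat (map h v) \<in> L} = {v. yields P' [Inl ([], [Inl S], [])] v}"
    proof (intro Set.set_eqI iffI)
      fix v assume "v \<in> {v \<in> lists \<Sigma>'. concat (map h v) \<in> L}"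
      then show "v \<in> {v. yields P' [Inl ([], [Inl S], [])] v}"
        using inv_productions_complete[of \<Sigma>' h \<Sigma> N F P "[Inl S]" "concat (map h v)" "[]" "[]" v,
            folded Q_def P'_def, OF hQ F FP _ FS Q0 Q0]
        by (simp add: L)
    next
      fix v assume "v \<in> {v. yields P' [Inl ([], [Inl S], [])] v}"
      then have v: "yields P' [Inl ([], [Inl S], [])] v" by simp
      with yields_in_lists[OF P'_sub this] start have "v \<in> lists \<Sigma>'" by auto
      moreover have "concat (map h v) \<in> L"
        using inv_productions_sound[OF v[unfolded P'_def]] by (auto simp: L)
      ultimately show "v \<in> {v \<in> lists \<Sigma>'. concat (map h v) \<in> L}" by simp
    qed
  qed
qed

section \<open>Evaluating words in a group\<close>

lemma (in group) word_hom_closed: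
  "\<psi> \<in> \<Sigma> \<rightarrow> carrier G \<Longrightarrow> w \<in> lists \<Sigma> \<Longrightarrow> word_hom G \<psi> w \<in> carrier G"
  by (induction w) (auto simp: word_hom_def)

lemma (in group) word_hom_append:
  assumes "\<psi> \<in> \<Sigma> \<rightarrow> carrier G" and "w2 \<in> lists \<Sigma>"
  shows "w1 \<in> lists \<Sigma> \<Longrightarrow> word_hom G \<psi> (w1 @ w2) = word_hom G \<psi> w1 \<otimes> word_hom G \<psi> w2"
proof (induction w1)
  case Nil
  then show ?case using word_hom_closed[OF assms] by (simp add: word_hom_def)
next
  case (Cons a w1)
  then have "word_hom G \<psi> w1 \<in> carrier G" "\<psi> a \<in> carrier G"
    using word_hom_closed[OF assms(1)] assms(1) by auto
  with Cons show ?case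
    using word_hom_closed[OF assms] by (simp add: word_hom_def m_assoc)
qed

text \<open>Both sides are multiplicative in \<open>v\<close> and agree on single letters.\<close>

lemma (in group) word_hom_concat_map:
  assumes \<psi>: "\<psi> \<in> \<Sigma> \<rightarrow> carrier G" and h: "h \<in> \<Sigma>' \<rightarrow> lists \<Sigma>"
    and eq: "\<And>b. b \<in> \<Sigma>' \<Longrightarrow> word_hom G \<psi> (h b) = \<psi>' b"
  shows "v \<in> lists \<Sigma>' \<Longrightarrow> word_hom G \<psi> (concat (map h v)) = word_hom G \<psi>' v"
proof (induction v)
  case Nil
  then show ?case by (simp add: word_hom_def)
next
  case (Cons b v)
  then have "h b \<in> lists \<Sigma>" "concat (map h v) \<in> lists \<Sigma>"
    using h by (fastforce simp: in_lists_conv_set)+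
  then have "word_hom G \<psi> (concat (map h (b # v))) = \<psi>' b \<otimes> word_hom G \<psi>' v"
    using Cons word_hom_append[OF \<psi>] eq by simp
  then show ?case by (simp add: word_hom_def)
qed

lemma (in group) context_free_pair_language_change:
  assumes \<psi>: "semigroup_presentation G \<Sigma> \<psi>" and \<psi>': "semigroup_presentation G \<Sigma>' \<psi>'"
    and cf: "context_free \<Sigma> (pair_language G K \<Sigma> \<psi>)"
  shows "context_free \<Sigma>' (pair_language G K \<Sigma>' \<psi>')"
proof -
  \<comment> \<open>Surjectivity of the extension of \<open>\<psi>\<close> provides the words from
    which \<open>h\<close> is chosen.\<close>
  have "\<exists>w \<in> lists \<Sigma>. word_hom G \<psi> w = \<psi>' b" if "b \<in> \<Sigma>'" for b
  proof -
    have "\<psi>' b \<in> word_hom G \<psi> ` lists \<Sigma>"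
      using that \<psi> \<psi>' by (auto simp: semigroup_presentation_def)
    then show ?thesis by force
  qed
  then obtain h where h: "h \<in> \<Sigma>' \<rightarrow> lists \<Sigma>" "\<And>b. b \<in> \<Sigma>' \<Longrightarrow> word_hom G \<psi> (h b) = \<psi>' b"
    by (metis Pi_I)
  have "concat (map h v) \<in> lists \<Sigma>" if "v \<in> lists \<Sigma>'" for v
    using that h(1) by (fastforce simp: in_lists_conv_set)
  then have "pair_language G K \<Sigma>' \<psi>' =
      {v \<in> lists \<Sigma>'. concat (map h v) \<in> pair_language G K \<Sigma> \<psi>}"
    using word_hom_concat_map[OF _ h] \<psi>
    by (simp add: pair_language_def semigroup_presentation_def cong: conj_cong)
  then show ?thesis
    using context_free_inverse_hom[OF cf _ h(1)] \<psi>' by (simp add: semigroup_presentation_def)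
qed

theorem corollary3p2:
  fixes G :: "('g, 'm) monoid_scheme"
    and K :: "'g set"
    and \<Sigma> :: "'a set" and \<psi> :: "'a \<Rightarrow> 'g"
    and \<Sigma>' :: "'b set" and \<psi>' :: "'b \<Rightarrow> 'g"
  assumes "group G"
    and "finitely_generated G"
    and "subgroup K G"
    and "semigroup_presentation G \<Sigma> \<psi>"
    and "semigroup_presentation G \<Sigma>' \<psi>'"
  shows "context_free \<Sigma> (pair_language G K \<Sigma> \<psi>) \<longleftrightarrow>
         context_free \<Sigma>' (pair_language G K \<Sigma>' \<psi>')"
  \<comment> \<open>The two presentations play symmetric roles, so one lemma gives both
    implications.\<close>
  by (rule iffI; rule group.context_free_pair_language_change[OF assms(1)]) (use assms(4,5) in simp_all)

end
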